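(* Let $t_0\in\mathbb{R}$, $n\ge 1$, $N_n=\{1,\dots,n\}$, and consider the scalar delay differential equation $$\dot{x}(t)+\sum_{j=1}^n a_j(t)x(h_j(t))=0,\qquad t\ge t_0, \qquad (E)$$ where $a_j,h_j:[t_0,\infty)\to\mathbb{R}$ are Lebesgue measurable, the $a_j$ are essentially bounded, and $0\le t-h_j(t)\le \tau_j$ for some constants $\tau_j\geq 0$, $j=1,\dots,n$. Put $A(t)=\sum_{j=1}^n a_j(t)$ and, for $\Omega\subset N_n$, $A_\Omega(t)=\sum_{j\in\Omega}a_j(t)$. Suppose there are a non-empty set $\Omega\subset N_n$ and a constant $\alpha>0$ such that $A_\Omega(t)\ge\alpha>0$ for $t\ge t_0$, and that at least one of the following holds: (a) $$\sum_{j=1}^n \tau_j\|a_j\|<1\quad\text{and}\quad \left(\sum_{j=1}^n\|a_j\|\right)\sum_{j\in\Omega}\tau_j\left\|\frac{a_j}{A_\Omega}\right\|+\sum_{j\in N_n\setminus\Omega}\left\|\frac{a_j}{A_\Omega}\right\|<1;$$ (b) $$\|A\|\sum_{j\in\Omega}\tau_j\left\|\frac{a_j}{A_\Omega}\right\|<\left(1-\sum_{j=1}^n\tau_j\|a_j\|\right)\left(1-\sum_{j\in N_n\setminus\Omega}\left\|\frac{a_j}{A_\Omega}\right\|\right).$$ Then equation (E) is uniformly exponentially stable.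
   Context: Here $\|y\|=\operatorname{ess\,sup}_{t\ge t_0}|y(t)|$ for measurable $y:[t_0,\infty)\to\mathbb{R}$. Inequalities between measurable functions are understood almost everywhere. For an initial point $s\ge t_0$ and a bounded Borel measurable initial function $\psi:(-\infty,s]\to\mathbb{R}$, a solution of (E) with these data is a function $x$ with $x(t)=\psi(t)$ for $t\le s$ that is absolutely continuous on each compact subinterval of $[s,\infty)$ and satisfies (E) for almost every $t\ge s$. Equation (E) is uniformly exponentially stable if there are constants $\mathcal{M}>0$ and $\nu>0$, independent of the initial point $s\ge t_0$ and of $\psi$, such that every such solution satisfies $|x(t)|\le \mathcal{M}e^{-\nu(t-s)}\sup_{\theta\le s}|\psi(\theta)|$ for all $t\ge s$.
   Formalization: Condition (b) is taken together with ∑τ_j‖a_j‖<1 (both factors on the right positive); if both factors may be negative the claim fails, e.g. for x'(t)+x(t)−2x(t−1)=0 with Ω={1}, τ_1=0, τ_2=1. *)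

theory Defs
  imports "HOL-Analysis.Analysis" "HOL-Probability.Essential_Supremum"
begin

text \<open>\<^term>\<open>esssup\<close> only exists for complete linear orders, hence the detour through \<^typ>\<open>ereal\<close>.
  The real-valued norm is meaningful only for essentially bounded measurable functions:
  \<^term>\<open>real_of_ereal\<close> maps an infinite supremum to 0.\<close>

definition ess_bounded_from :: "real \<Rightarrow> (real \<Rightarrow> real) \<Rightarrow> bool" where
  "ess_bounded_from t0 y \<longleftrightarrow> esssup (lebesgue_on {t0..}) (\<lambda>t. ereal \<bar>y t\<bar>) < \<infinity>"

definition ess_norm :: "real \<Rightarrow> (real \<Rightarrow> real) \<Rightarrow> real" where
  "ess_norm t0 y = real_of_ereal (esssup (lebesgue_on {t0..}) (\<lambda>t. ereal \<bar>y t\<bar>))"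

text \<open>Absolute continuity of a function (the constant \<^term>\<open>absolutely_continuous\<close> of the library is
  the notion for measures). The indices \<open>k < m\<close> enumerate a finite family of pairwise disjoint
  open subintervals of \<open>[c, d]\<close>.\<close>

definition abs_continuous_on_interval :: "real \<Rightarrow> real \<Rightarrow> (real \<Rightarrow> real) \<Rightarrow> bool" where
  "abs_continuous_on_interval c d f \<longleftrightarrow>
     (\<forall>\<epsilon>>0. \<exists>\<delta>>0. \<forall>(m::nat) u v.
        (\<forall>k<m. c \<le> u k \<and> u k \<le> v k \<and> v k \<le> d) \<longrightarrow>
        disjoint_family_on (\<lambda>k. {u k<..<v k}) {..<m} \<longrightarrow>
        (\<Sum>k<m. v k - u k) < \<delta> \<longrightarrow>
        (\<Sum>k<m. \<bar>f (v k) - f (u k)\<bar>) < \<epsilon>)"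

text \<open>Functions on \<open>(-\<infinity>, s]\<close> and \<open>[t\<^sub>0, \<infinity>)\<close> are total functions whose values elsewhere are irrelevant.
  In the equation below, as \<open>t \<ge> s\<close>, the coefficients are only evaluated on their domain
  if \<open>s \<ge> t\<^sub>0\<close>.\<close>

definition initial_function :: "real \<Rightarrow> (real \<Rightarrow> real) \<Rightarrow> bool" where
  "initial_function s \<psi> \<longleftrightarrow>
     \<psi> \<in> borel_measurable (restrict_space borel {..s}) \<and> bounded (\<psi> ` {..s})"

definition is_solution ::
  "nat \<Rightarrow> (nat \<Rightarrow> real \<Rightarrow> real) \<Rightarrow> (nat \<Rightarrow> real \<Rightarrow> real) \<Rightarrow> real \<Rightarrow> (real \<Rightarrow> real) \<Rightarrow> (real \<Rightarrow> real) \<Rightarrow> bool"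
where
  "is_solution n a h s \<psi> x \<longleftrightarrow>
     (\<forall>t\<le>s. x t = \<psi> t) \<and>
     (\<forall>c d. s \<le> c \<longrightarrow> c \<le> d \<longrightarrow> abs_continuous_on_interval c d x) \<and>
     (AE t in lebesgue_on {s..}.
        x differentiable (at t) \<and> deriv x t + (\<Sum>j=1..n. a j t * x (h j t)) = 0)"

definition uniformly_exponentially_stable ::
  "real \<Rightarrow> nat \<Rightarrow> (nat \<Rightarrow> real \<Rightarrow> real) \<Rightarrow> (nat \<Rightarrow> real \<Rightarrow> real) \<Rightarrow> bool"
where
  "uniformly_exponentially_stable t0 n a h \<longleftrightarrow>
     (\<exists>M>0. \<exists>\<nu>>0. \<forall>s\<ge>t0. \<forall>\<psi> x.
        initial_function s \<psi> \<longrightarrow> is_solution n a h s \<psi> x \<longrightarrow>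
        (\<forall>t\<ge>s. \<bar>x t\<bar> \<le> M * exp (- \<nu> * (t - s)) * (SUP \<theta>\<in>{..s}. \<bar>\<psi> \<theta>\<bar>)))"

end

theory Submission
  imports Defs
begin

text \<open>
  Multiplying a solution by \<open>exp (\<nu> * (t - s))\<close> gives a solution \<open>y\<close> of the same equation up to a
  perturbation that is small compared with \<open>m = sup \<bar>y\<bar>\<close> when \<open>\<nu>\<close> is small, so it suffices to bound
  \<open>y\<close> by the initial data, uniformly in the length of the time interval.
  If \<open>D\<close> is a Lipschitz constant of \<open>y\<close>, then \<open>\<bar>y t - y (h j t)\<bar>\<close> is at most \<open>\<tau> j * D\<close> up to initial
  data, and writing the equation as \<open>y' = A\<^sub>\<Omega> * (g - y)\<close> shows that \<open>\<bar>y\<bar>\<close> cannot exceed \<open>sup \<bar>g\<bar>\<close>,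
  where \<open>\<bar>g\<bar>\<close> is controlled by \<open>D\<close> (indices in \<open>\<Omega>\<close>) and by \<open>m\<close> (the other indices). In case (a), \<open>D\<close> is
  read off the equation; in case (b), the equation \<open>y' = - A * y + (\<Sum>j. a j * (y - y \<circ> h j))\<close> improves
  any Lipschitz constant \<open>D\<close> to \<open>K * D + B\<close> with \<open>K < 1\<close>. Either way \<open>m \<le> \<theta> * m + initial data\<close> with
  \<open>\<theta> < 1\<close>.
\<close>

subsection \<open>Absolutely continuous functions\<close>

text \<open>Brings absolute continuity into the form used with gauges. The smallness condition
  becomes the measure of an open set \<open>U\<close> containing the intervals, so that
  \<open>U\<close> can later be a thin neighbourhood of an exceptional null set.\<close>

lemma abs_continuous_on_intervalD_tagged:
  assumes "abs_continuous_on_interval c d f" "e > 0"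
  obtains \<delta> where "\<delta> > 0"
    "\<And>p U. \<lbrakk>p tagged_partial_division_of {c..d}; open U; emeasure lebesgue U < ennreal \<delta>;
        \<And>x K. (x, K) \<in> p \<Longrightarrow> K \<subseteq> U\<rbrakk>
      \<Longrightarrow> (\<Sum>(x, K)\<in>p. \<bar>f (Sup K) - f (Inf K)\<bar>) < e"
proof -
  obtain \<delta> where "\<delta> > 0" and \<delta>:
    "\<forall>(m::nat) u v. (\<forall>k<m. c \<le> u k \<and> u k \<le> v k \<and> v k \<le> d) \<longrightarrow>
        disjoint_family_on (\<lambda>k. {u k<..<v k}) {..<m} \<longrightarrow> (\<Sum>k<m. v k - u k) < \<delta> \<longrightarrow>
        (\<Sum>k<m. \<bar>f (v k) - f (u k)\<bar>) < e"
    using assms(1)[unfolded abs_continuous_on_interval_def, THEN spec, THEN mp, OF assms(2)]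
    by (elim exE conjE) (rule that)
  have "(\<Sum>(x, K)\<in>p. \<bar>f (Sup K) - f (Inf K)\<bar>) < e"
    if p: "p tagged_partial_division_of {c..d}" and U: "open U" "emeasure lebesgue U < ennreal \<delta>"
      and sub: "\<And>x K. (x, K) \<in> p \<Longrightarrow> K \<subseteq> U" for p U
  proof -
    have "finite p" using p unfolding tagged_partial_division_of_def by blast
    then obtain q where q: "bij_betw q {..<card p} p"
      using ex_bij_betw_nat_finite[of p] by (auto simp: atLeast0LessThan)
    define u v where "u k = Inf (snd (q k))" and "v k = Sup (snd (q k))" for k
    have qp: "q k \<in> p" if "k < card p" for k
      using q that by (auto simp: bij_betw_def)
    have K: "snd (q k) = {u k..v k} \<and> c \<le> u k \<and> u k \<le> v k \<and> v k \<le> d" if "k < card p" for k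
    proof -
      obtain x K where xK: "q k = (x, K)" by force
      then have "(x, K) \<in> p" using qp[OF that] by simp
      then have "x \<in> K" "K \<subseteq> {c..d}" "\<exists>a b. K = cbox a b"
        using p unfolding tagged_partial_division_of_def by blast+
      then show ?thesis using xK unfolding u_def v_def by auto
    qed
    have disj: "disjoint_family_on (\<lambda>k. {u k<..<v k}) {..<card p}"
      unfolding disjoint_family_on_def
    proof (intro ballI impI)
      fix i j assume ij: "i \<in> {..<card p}" "j \<in> {..<card p}" "i \<noteq> j"
      then have "q i \<noteq> q j" using q by (auto simp: bij_betw_def inj_on_def)
      then have "interior (snd (q i)) \<inter> interior (snd (q j)) = {}"
        using p qp[of i] qp[of j] ij unfolding tagged_partial_division_of_def
        by (metis lessThan_iff prod.collapse)
      then show "{u i<..<v i} \<inter> {u j<..<v j} = {}"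
        using K ij by simp
    qed
    \<comment> \<open>The open interiors are pairwise disjoint subsets of \<open>U\<close>, so their
      total length is at most the measure of \<open>U\<close>.\<close>
    have "ennreal (\<Sum>k<card p. v k - u k) = (\<Sum>k<card p. emeasure lebesgue {u k<..<v k})"
      using K by (subst sum_ennreal[symmetric]) (auto intro!: sum.cong simp: less_imp_le)
    also have "\<dots> = emeasure lebesgue (\<Union>k<card p. {u k<..<v k})"
      using disj by (intro sum_emeasure) auto
    also have "\<dots> \<le> emeasure lebesgue U"
    proof (rule emeasure_mono)
      show "(\<Union>k<card p. {u k<..<v k}) \<subseteq> U"
      proof (rule UN_least)
        fix k assume "k \<in> {..<card p}"
        then have k: "k < card p" by simp
        have "snd (q k) \<subseteq> U" using sub[of "fst (q k)" "snd (q k)"] qp[OF k] by simp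
        moreover have "{u k<..<v k} \<subseteq> {u k..v k}" by auto
        ultimately show "{u k<..<v k} \<subseteq> U" using K[OF k] by auto
      qed
    qed (use U in auto)
    finally have "ennreal (\<Sum>k<card p. v k - u k) < ennreal \<delta>"
      using U(2) by (rule le_less_trans)
    moreover have "0 \<le> (\<Sum>k<card p. v k - u k)" using K by (intro sum_nonneg) auto
    ultimately have "(\<Sum>k<card p. v k - u k) < \<delta>" by (simp add: ennreal_less_iff)
    then have "(\<Sum>k<card p. \<bar>f (v k) - f (u k)\<bar>) < e"
      using \<delta> K disj by blast
    also have "(\<Sum>k<card p. \<bar>f (v k) - f (u k)\<bar>) = (\<Sum>(x, K)\<in>p. \<bar>f (Sup K) - f (Inf K)\<bar>)"
      unfolding u_def v_def by (subst sum.reindex_bij_betw[OF q, symmetric]) (simp add: case_prod_beta)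
    finally show ?thesis .
  qed
  with \<open>\<delta> > 0\<close> show ?thesis using that by blast
qed

text \<open>One-sided straddle lemma: as \<open>t\<close> lies between \<open>u\<close> and
  \<open>v\<close>, the errors \<open>e * (v - t)\<close> and \<open>e * (t - u)\<close> of the
  linear approximations add up to just \<open>e * (v - u)\<close>.\<close>

lemma straddle_le:
  fixes f :: "real \<Rightarrow> real"
  assumes "(f has_real_derivative D) (at t)" "e > 0"
  obtains r where "r > 0"
    "\<And>u v. \<lbrakk>u \<le> t; t \<le> v; t - u < r; v - t < r\<rbrakk> \<Longrightarrow> f v - f u \<le> (D + e) * (v - u)"
proof -
  obtain r where "r > 0" and r: "\<And>z. \<bar>z - t\<bar> < r \<Longrightarrow> \<bar>f z - f t - D * (z - t)\<bar> \<le> e * \<bar>z - t\<bar>"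
    using assms unfolding has_field_derivative_def has_derivative_at_alt by (auto simp: mult.commute)
  have "f v - f u \<le> (D + e) * (v - u)" if "u \<le> t" "t \<le> v" "t - u < r" "v - t < r" for u v
  proof -
    have "f v - f t \<le> D * (v - t) + e * (v - t)" "D * (u - t) - e * (t - u) \<le> f u - f t"
      using r[of u] r[of v] that by (simp_all add: abs_le_iff)
    moreover have "(D + e) * (v - u) = (D * (v - t) + e * (v - t)) - (D * (u - t) - e * (t - u))"
      by (simp add: algebra_simps)
    ultimately show ?thesis by linarith
  qed
  with \<open>r > 0\<close> show ?thesis using that by blast
qed

text \<open>A mean value inequality proved without integration. In a fine tagged division, intervals
  with tags outside \<open>N\<close> obey the straddle estimate; those with tags in \<open>N\<close>
  lie in an open set of small measure and contribute at most \<open>e\<close> by absolute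
  continuity. The increments telescope to \<open>f d - f c\<close>.\<close>

lemma abs_continuous_increment_le:
  assumes ac: "abs_continuous_on_interval c d f" and "c \<le> d" and "B \<ge> 0" and N: "negligible N"
    and der: "\<And>t. t \<in> {c..d} - N \<Longrightarrow> \<exists>D\<le>B. (f has_real_derivative D) (at t)"
  shows "f d - f c \<le> B * (d - c)"
proof -
  have main: "f d - f c \<le> (B + e) * (d - c) + e" if "e > 0" for e
  proof -
    obtain \<delta> where "\<delta> > 0" and \<delta>:
      "\<And>p U. \<lbrakk>p tagged_partial_division_of {c..d}; open U; emeasure lebesgue U < ennreal \<delta>;
        \<And>x K. (x, K) \<in> p \<Longrightarrow> K \<subseteq> U\<rbrakk>
      \<Longrightarrow> (\<Sum>(x, K)\<in>p. \<bar>f (Sup K) - f (Inf K)\<bar>) < e"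
      using abs_continuous_on_intervalD_tagged[OF ac \<open>e > 0\<close>] by blast
    have Nl: "N \<in> null_sets lebesgue" using N by (simp add: negligible_iff_null_sets)
    then obtain U where U: "open U" "N \<subseteq> U" "U - N \<in> lmeasurable" "emeasure lebesgue (U - N) < ennreal \<delta>"
      using sets_lebesgue_outer_open[of N \<delta>] \<open>\<delta> > 0\<close> by blast
    have "emeasure lebesgue U < ennreal \<delta>"
      using U Nl emeasure_Diff_null_set[of N lebesgue U] by simp
    have "\<exists>r>0. t \<notin> N \<longrightarrow> t \<in> {c..d} \<longrightarrow>
        (\<forall>u v. u \<le> t \<longrightarrow> t \<le> v \<longrightarrow> t - u < r \<longrightarrow> v - t < r \<longrightarrow> f v - f u \<le> (B + e) * (v - u))" for t
    proof (cases "t \<in> {c..d} - N")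
      case True
      then obtain D where D: "D \<le> B" "(f has_real_derivative D) (at t)" using der by blast
      obtain r where "r > 0" and r:
        "\<And>u v. \<lbrakk>u \<le> t; t \<le> v; t - u < r; v - t < r\<rbrakk> \<Longrightarrow> f v - f u \<le> (D + e) * (v - u)"
        using straddle_le[OF D(2) \<open>e > 0\<close>] by blast
      have "f v - f u \<le> (B + e) * (v - u)" if "u \<le> t" "t \<le> v" "t - u < r" "v - t < r" for u v
        using r[OF that] mult_right_mono[of "D + e" "B + e" "v - u"] D that by linarith
      with \<open>r > 0\<close> show ?thesis by blast
    qed (auto intro: exI[of _ 1])
    then obtain r where r0: "\<And>t. r t > 0" and r:
      "\<And>t u v. \<lbrakk>t \<notin> N; t \<in> {c..d}; u \<le> t; t \<le> v; t - u < r t; v - t < r t\<rbrakk> \<Longrightarrow> f v - f u \<le> (B + e) * (v - u)"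
      by metis
    \<comment> \<open>At points of \<open>N\<close> the gauge confines the interval to
      \<open>U\<close>; elsewhere it enforces the radius of the straddle estimate.\<close>
    define \<gamma> where "\<gamma> t = (if t \<in> N then U else ball t (r t))" for t
    have "gauge \<gamma>"
      using r0 U unfolding gauge_def \<gamma>_def by auto
    then obtain p where p: "p tagged_division_of {c..d}" and fine: "\<gamma> fine p"
      using fine_division_exists_real by blast
    note pD = tagged_division_ofD[OF p]
    have fin: "finite p" by (rule pD)
    define p1 where "p1 = {xK \<in> p. fst xK \<in> N}"
    define p2 where "p2 = p - p1"
    have p12: "p = p1 \<union> p2" "p1 \<inter> p2 = {}" "finite p1" "finite p2"
      using fin by (auto simp: p1_def p2_def)
    have ivl: "Inf K \<le> x \<and> x \<le> Sup K \<and> Inf K \<in> K \<and> Sup K \<in> K \<and> x \<in> {c..d}" if "(x, K) \<in> p" for x K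
    proof -
      have "\<exists>a b. K = cbox a b" "x \<in> K" "K \<subseteq> {c..d}" using that pD(2-4) by presburger+
      then show ?thesis by fastforce
    qed
    have "(\<Sum>(x, K)\<in>p1. \<bar>f (Sup K) - f (Inf K)\<bar>) < e"
    proof (rule \<delta>)
      show "p1 tagged_partial_division_of {c..d}"
        using p unfolding p1_def tagged_division_of_def
        by (auto intro: tagged_partial_division_subset)
      show "K \<subseteq> U" if "(x, K) \<in> p1" for x K
        using that fine unfolding p1_def fine_def \<gamma>_def by fastforce
    qed fact+
    then have 1: "(\<Sum>(x, K)\<in>p1. f (Sup K) - f (Inf K)) \<le> e"
      using sum_mono[of p1 "\<lambda>(x, K). f (Sup K) - f (Inf K)" "\<lambda>(x, K). \<bar>f (Sup K) - f (Inf K)\<bar>"] by fastforce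
    have tele: "(\<Sum>(x, K)\<in>p. g (Sup K) - g (Inf K)) = g d - g c" for g :: "real \<Rightarrow> real"
      using additive_tagged_division_1[OF \<open>c \<le> d\<close> p] by simp
    have 2: "(\<Sum>(x, K)\<in>p2. f (Sup K) - f (Inf K)) \<le> (\<Sum>(x, K)\<in>p2. (B + e) * (Sup K - Inf K))"
    proof (rule sum_mono, clarify)
      fix x K assume xK: "(x, K) \<in> p2"
      then have xp: "(x, K) \<in> p" and "x \<notin> N" by (auto simp: p1_def p2_def)
      moreover have "K \<subseteq> ball x (r x)"
        using fine xp \<open>x \<notin> N\<close> unfolding fine_def \<gamma>_def by fastforce
      ultimately show "f (Sup K) - f (Inf K) \<le> (B + e) * (Sup K - Inf K)"
        using ivl[OF xp] by (intro r[of x]) (auto simp: dist_real_def subset_iff)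
    qed
    have "f d - f c = (\<Sum>(x, K)\<in>p1. f (Sup K) - f (Inf K)) + (\<Sum>(x, K)\<in>p2. f (Sup K) - f (Inf K))"
      unfolding tele[of f, symmetric] by (subst p12(1)) (intro sum.union_disjoint p12)
    also have "\<dots> \<le> e + (\<Sum>(x, K)\<in>p2. (B + e) * (Sup K - Inf K))"
      using 1 2 by linarith
    \<comment> \<open>The intervals tagged in \<open>N\<close> can be added back because
      \<open>B + e\<close> is nonnegative; the full sum then telescopes.\<close>
    also have "(\<Sum>(x, K)\<in>p2. (B + e) * (Sup K - Inf K)) \<le> (\<Sum>(x, K)\<in>p. (B + e) * (Sup K - Inf K))"
      using ivl p12 fin \<open>e > 0\<close> \<open>B \<ge> 0\<close> by (intro sum_mono2) (fastforce intro!: mult_nonneg_nonneg)+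
    also have "\<dots> = (B + e) * (d - c)"
      using tele[of "\<lambda>x. (B + e) * x"] by (simp add: right_diff_distrib)
    finally show ?thesis by simp
  qed
  have "((\<lambda>e. (B + e) * (d - c) + e) \<longlongrightarrow> (B + 0) * (d - c) + 0) (at_right 0)"
    by (intro tendsto_intros)
  then show ?thesis
    by (intro tendsto_lowerbound[of _ "B * (d - c)" "at_right 0"])
      (auto simp: eventually_at_right_less intro: eventually_mono[OF eventually_at_right_less main])
qed

section \<open>Closure properties, barriers and Lipschitz bounds\<close>

lemma abs_continuous_on_interval_subset:
  assumes "abs_continuous_on_interval c d f" "c \<le> c'" "d' \<le> d"
  shows "abs_continuous_on_interval c' d' f"
  unfolding abs_continuous_on_interval_def
proof (intro allI impI)
  fix e :: real assume "e > 0"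
  from assms(1)[unfolded abs_continuous_on_interval_def, THEN spec, THEN mp, OF this]
  show "\<exists>\<delta>>0. \<forall>(m::nat) u v. (\<forall>k<m. c' \<le> u k \<and> u k \<le> v k \<and> v k \<le> d') \<longrightarrow>
      disjoint_family_on (\<lambda>k. {u k<..<v k}) {..<m} \<longrightarrow> (\<Sum>k<m. v k - u k) < \<delta> \<longrightarrow>
      (\<Sum>k<m. \<bar>f (v k) - f (u k)\<bar>) < e"
    using assms(2,3) by (elim ex_forward conj_forward all_forward imp_forward) (auto intro: order_trans)
qed

lemma abs_continuous_on_interval_uminus:
  "abs_continuous_on_interval c d f \<Longrightarrow> abs_continuous_on_interval c d (\<lambda>t. - f t)"
  by (simp add: abs_continuous_on_interval_def abs_minus_commute)

lemma abs_continuous_on_interval_imp_continuous_on: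
  assumes "abs_continuous_on_interval c d f"
  shows "continuous_on {c..d} f"
  unfolding continuous_on_iff dist_real_def
proof (intro ballI allI impI)
  fix x e :: real assume "x \<in> {c..d}" "e > 0"
  from assms[unfolded abs_continuous_on_interval_def, THEN spec, THEN mp, OF \<open>e > 0\<close>]
  obtain \<delta> where "\<delta> > 0" and
    \<delta>: "\<forall>(m::nat) u v. (\<forall>k<m. c \<le> u k \<and> u k \<le> v k \<and> v k \<le> d) \<longrightarrow>
      disjoint_family_on (\<lambda>k. {u k<..<v k}) {..<m} \<longrightarrow> (\<Sum>k<m. v k - u k) < \<delta> \<longrightarrow>
      (\<Sum>k<m. \<bar>f (v k) - f (u k)\<bar>) < e"
    by (elim exE conjE) (rule that)
  have *: "\<bar>f v - f u\<bar> < e" if "c \<le> u" "u \<le> v" "v \<le> d" "v - u < \<delta>" for u v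
    using \<delta>[rule_format, of 1 "\<lambda>_. u" "\<lambda>_. v"] that by (simp add: disjoint_family_on_def)
  have "\<bar>f x' - f x\<bar> < e" if "x' \<in> {c..d}" "\<bar>x' - x\<bar> < \<delta>" for x'
    using *[of x x'] *[of x' x] that \<open>x \<in> {c..d}\<close> by (cases "x \<le> x'") (auto simp: abs_minus_commute)
  with \<open>\<delta> > 0\<close> show "\<exists>\<delta>>0. \<forall>x'\<in>{c..d}. \<bar>x' - x\<bar> < \<delta> \<longrightarrow> \<bar>f x' - f x\<bar> < e"
    by blast
qed

text \<open>Each increment of the product splits into \<open>g v * (f v - f u)\<close> and
  \<open>(g v - g u) * f u\<close>. With \<open>f\<close> and \<open>g\<close> bounded on the
  compact interval, the first kind is summed by absolute continuity of \<open>f\<close>, the second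
  by the total length. The application has an exponential weight as \<open>g\<close>.\<close>

lemma abs_continuous_on_interval_lipschitz_mult:
  fixes f g :: "real \<Rightarrow> real"
  assumes ac: "abs_continuous_on_interval c d f"
    and L: "L-lipschitz_on {c..d} g"
  shows "abs_continuous_on_interval c d (\<lambda>t. g t * f t)"
proof -
  have "bounded (f ` {c..d})" "bounded (g ` {c..d})"
    using abs_continuous_on_interval_imp_continuous_on[OF ac] lipschitz_on_continuous_on[OF L]
    by (auto intro!: compact_imp_bounded compact_continuous_image)
  then obtain B C where "B > 0" "C > 0" and B: "\<And>t. t \<in> {c..d} \<Longrightarrow> \<bar>f t\<bar> \<le> B"
    and C: "\<And>t. t \<in> {c..d} \<Longrightarrow> \<bar>g t\<bar> \<le> C"
    by (auto simp: bounded_pos)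
  have "L \<ge> 0" using L by (rule lipschitz_on_nonneg)
  have incr: "\<bar>g v * f v - g u * f u\<bar> \<le> C * \<bar>f v - f u\<bar> + L * B * (v - u)"
    if "c \<le> u" "u \<le> v" "v \<le> d" for u v
  proof -
    have "g v * f v - g u * f u = g v * (f v - f u) + (g v - g u) * f u" by (simp add: algebra_simps)
    then have "\<bar>g v * f v - g u * f u\<bar> \<le> \<bar>g v\<bar> * \<bar>f v - f u\<bar> + \<bar>g v - g u\<bar> * \<bar>f u\<bar>"
      by (metis abs_mult abs_triangle_ineq)
    also have "\<dots> \<le> C * \<bar>f v - f u\<bar> + (L * (v - u)) * B"
    proof (intro add_mono mult_mono)
      show "\<bar>g v\<bar> \<le> C" "\<bar>f u\<bar> \<le> B" using that by (auto intro: B C)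
      show "\<bar>g v - g u\<bar> \<le> L * (v - u)"
        using lipschitz_onD[OF L, of v u] that by (simp add: dist_real_def)
    qed (use that \<open>L \<ge> 0\<close> \<open>C > 0\<close> in simp_all)
    finally show ?thesis by (simp add: mult_ac)
  qed
  show ?thesis
    unfolding abs_continuous_on_interval_def
  proof (intro allI impI)
    fix e :: real assume "e > 0"
    then have "e / (2 * C) > 0" using \<open>C > 0\<close> by simp
    from ac[unfolded abs_continuous_on_interval_def, THEN spec, THEN mp, OF this]
    obtain \<delta> where "\<delta> > 0" and
      \<delta>: "\<forall>(m::nat) u v. (\<forall>k<m. c \<le> u k \<and> u k \<le> v k \<and> v k \<le> d) \<longrightarrow>
        disjoint_family_on (\<lambda>k. {u k<..<v k}) {..<m} \<longrightarrow> (\<Sum>k<m. v k - u k) < \<delta> \<longrightarrow>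
        (\<Sum>k<m. \<bar>f (v k) - f (u k)\<bar>) < e / (2 * C)"
      by (elim exE conjE) (rule that)
    \<comment> \<open>Each of the two bounds in the minimum accounts for \<open>e / 2\<close>; the
      summand 1 keeps the denominator positive when \<open>L\<close> is 0.\<close>
    define \<eta> where "\<eta> = min \<delta> (e / (2 * (L * B + 1)))"
    have LB: "L * B + 1 > 0" using \<open>L \<ge> 0\<close> \<open>B > 0\<close> by (simp add: add_nonneg_pos)
    then have "\<eta> > 0" using \<open>\<delta> > 0\<close> \<open>e > 0\<close> by (simp add: \<eta>_def)
    have "(\<Sum>k<m. \<bar>g (v k) * f (v k) - g (u k) * f (u k)\<bar>) < e"
      if uv: "\<forall>k<m. c \<le> u k \<and> u k \<le> v k \<and> v k \<le> d"
        and dj: "disjoint_family_on (\<lambda>k. {u k<..<v k}) {..<m}"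
        and len: "(\<Sum>k<m. v k - u k) < \<eta>" for m :: nat and u v
    proof -
      have "(\<Sum>k<m. \<bar>f (v k) - f (u k)\<bar>) < e / (2 * C)"
        using \<delta>[THEN spec[of _ m], THEN spec[of _ u], THEN spec[of _ v], THEN mp, OF uv, THEN mp, OF dj] len
        by (simp add: \<eta>_def)
      then have 1: "C * (\<Sum>k<m. \<bar>f (v k) - f (u k)\<bar>) < e / 2"
        using \<open>C > 0\<close> by (simp add: field_simps)
      have "0 \<le> (\<Sum>k<m. v k - u k)" using uv by (intro sum_nonneg) auto
      then have "L * B * (\<Sum>k<m. v k - u k) \<le> (L * B + 1) * (\<Sum>k<m. v k - u k)"
        by (intro mult_right_mono) auto
      also have "\<dots> \<le> (L * B + 1) * (e / (2 * (L * B + 1)))"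
        using len LB by (intro mult_left_mono) (auto simp: \<eta>_def)
      also have "\<dots> = e / 2"
      proof -
        have "z * (e / (2 * z)) = e / 2" if "z > 0" for z using that by simp
        with LB show ?thesis by blast
      qed
      finally have 2: "L * B * (\<Sum>k<m. v k - u k) \<le> e / 2" .
      have "(\<Sum>k<m. \<bar>g (v k) * f (v k) - g (u k) * f (u k)\<bar>)
          \<le> (\<Sum>k<m. C * \<bar>f (v k) - f (u k)\<bar> + L * B * (v k - u k))"
        using uv incr by (intro sum_mono) auto
      also have "\<dots> = C * (\<Sum>k<m. \<bar>f (v k) - f (u k)\<bar>) + L * B * (\<Sum>k<m. v k - u k)"
        by (simp only: sum.distrib sum_distrib_left)
      finally show ?thesis using 1 2 by linarith
    qed
    with \<open>\<eta> > 0\<close> show "\<exists>\<delta>>0. \<forall>(m::nat) u v. (\<forall>k<m. c \<le> u k \<and> u k \<le> v k \<and> v k \<le> d) \<longrightarrow>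
        disjoint_family_on (\<lambda>k. {u k<..<v k}) {..<m} \<longrightarrow> (\<Sum>k<m. v k - u k) < \<delta> \<longrightarrow>
        (\<Sum>k<m. \<bar>g (v k) * f (v k) - g (u k) * f (u k)\<bar>) < e"
      by (intro exI[of _ \<eta>] conjI allI impI) assumption
  qed
qed

text \<open>A maximum principle: if \<open>y t\<close> exceeded \<open>B\<close>, then after the
  last time with \<open>y\<close> at most \<open>B\<close> the derivative would be nonpositive
  almost everywhere, so \<open>y\<close> could not have risen above \<open>B\<close>.\<close>

lemma abs_continuous_le_barrier:
  assumes ac: "abs_continuous_on_interval c d y" and "y c \<le> B" and N: "negligible N"
    and der: "\<And>t. \<lbrakk>t \<in> {c..d} - N; y t > B\<rbrakk> \<Longrightarrow> \<exists>D\<le>0. (y has_real_derivative D) (at t)"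
    and t: "t \<in> {c..d}"
  shows "y t \<le> B"
proof (rule ccontr)
  assume "\<not> y t \<le> B"
  define S where "S = {u \<in> {c..t}. y u \<le> B}"
  have cont: "continuous_on {c..t} y"
    using abs_continuous_on_interval_imp_continuous_on[OF ac] t by (auto intro: continuous_on_subset)
  have "closed S" unfolding S_def
    by (intro continuous_on_closed_Collect_le cont) auto
  moreover have "c \<in> S" "bdd_above S" using assms(2) t by (auto simp: S_def)
  ultimately have "Sup S \<in> S" by (intro closed_contains_Sup) auto
  have after: "y u > B" if "Sup S < u" "u \<le> t" for u
    using that cSup_upper[OF _ \<open>bdd_above S\<close>, of u] \<open>Sup S \<in> S\<close> by (force simp: S_def)
  have "y t - y (Sup S) \<le> 0 * (t - Sup S)"
  proof (rule abs_continuous_increment_le)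
    show "abs_continuous_on_interval (Sup S) t y"
      using ac \<open>Sup S \<in> S\<close> t by (auto simp: S_def intro: abs_continuous_on_interval_subset)
    \<comment> \<open>At \<open>Sup S\<close> itself \<open>y\<close> is still at most
      \<open>B\<close>, so \<open>der\<close> gives nothing there and the point joins the
      exceptional set.\<close>
    show "negligible (insert (Sup S) N)" using N by simp
    show "\<exists>D\<le>0. (y has_real_derivative D) (at u)" if "u \<in> {Sup S..t} - insert (Sup S) N" for u
      using that \<open>Sup S \<in> S\<close> t by (intro der after) (auto simp: S_def)
  qed (use \<open>Sup S \<in> S\<close> in \<open>auto simp: S_def\<close>)
  with \<open>Sup S \<in> S\<close> \<open>\<not> y t \<le> B\<close> show False by (auto simp: S_def)
qed

lemma abs_continuous_lipschitz:
  assumes ac: "abs_continuous_on_interval c d y" and "D \<ge> 0" and N: "negligible N"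
    and der: "\<And>t. t \<in> {c..d} - N \<Longrightarrow> \<exists>y'. (y has_real_derivative y') (at t) \<and> \<bar>y'\<bar> \<le> D"
  shows "D-lipschitz_on {c..d} y"
proof -
  have *: "\<bar>y v - y u\<bar> \<le> D * (v - u)" if uv: "c \<le> u" "u \<le> v" "v \<le> d" for u v
  proof -
    have ac': "abs_continuous_on_interval u v y"
      using abs_continuous_on_interval_subset[OF ac] uv by simp
    have "\<exists>E\<le>D. (y has_real_derivative E) (at t)"
      "\<exists>E\<le>D. ((\<lambda>t. - y t) has_real_derivative E) (at t)" if t: "t \<in> {u..v} - N" for t
    proof -
      obtain y' where y': "(y has_real_derivative y') (at t)" "\<bar>y'\<bar> \<le> D"
        using der[of t] t uv by auto
      then have "y' \<le> D" "- y' \<le> D" by auto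
      then show "\<exists>E\<le>D. (y has_real_derivative E) (at t)"
        "\<exists>E\<le>D. ((\<lambda>t. - y t) has_real_derivative E) (at t)"
        using y'(1) DERIV_minus[OF y'(1)] by (auto intro: exI[of _ y'] exI[of _ "- y'"])
    qed
    then have "y v - y u \<le> D * (v - u)" "- y v - - y u \<le> D * (v - u)"
      by (intro abs_continuous_increment_le[OF ac' \<open>u \<le> v\<close> \<open>D \<ge> 0\<close> N]
          abs_continuous_increment_le[OF abs_continuous_on_interval_uminus[OF ac'] \<open>u \<le> v\<close> \<open>D \<ge> 0\<close> N]; blast)+
    then show ?thesis by linarith
  qed
  show ?thesis
  proof (rule lipschitz_onI)
    fix u v assume "u \<in> {c..d}" "v \<in> {c..d}"
    then show "dist (y u) (y v) \<le> D * dist u v"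
      using *[of u v] *[of v u] by (cases "u \<le> v") (auto simp: dist_real_def abs_minus_commute)
  qed fact
qed

text \<open>Iterating the affine contraction \<open>D \<mapsto> K * D + B\<close> from any Lipschitz
  constant converges to its fixed point \<open>B / (1 - K)\<close>, and the Lipschitz inequality
  survives the limit.\<close>

lemma lipschitz_on_fixed_bound:
  fixes y :: "real \<Rightarrow> real"
  assumes "0 \<le> K" "K < 1" "0 \<le> B" "D-lipschitz_on S y"
    and step: "\<And>D. D-lipschitz_on S y \<Longrightarrow> (K * D + B)-lipschitz_on S y"
  shows "(B / (1 - K))-lipschitz_on S y"
proof (rule lipschitz_onI)
  define q where "q = B / (1 - K)"
  have "B = (1 - K) * q" using \<open>K < 1\<close> by (simp add: q_def)
  then have B: "B = q - K * q" by (simp add: algebra_simps)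
  \<comment> \<open>Closed form of the \<open>k\<close>-th iterate started at \<open>D\<close>, with
    \<open>q\<close> the fixed point.\<close>
  define E where "E k = q + K ^ k * (D - q)" for k
  have *: "(E k)-lipschitz_on S y" for k
  proof (induction k)
    case (Suc k)
    have "E (Suc k) = K * E k + B"
      unfolding E_def B by (simp add: algebra_simps)
    with step[OF Suc] show ?case by simp
  qed (simp add: E_def assms)
  fix u v assume uv: "u \<in> S" "v \<in> S"
  have "(\<lambda>k. E k * dist u v) \<longlonglongrightarrow> (q + 0 * (D - q)) * dist u v"
    unfolding E_def using assms by (intro tendsto_intros LIMSEQ_power_zero) auto
  then show "dist (y u) (y v) \<le> B / (1 - K) * dist u v"
    using lipschitz_onD[OF * uv] unfolding q_def[symmetric]
    by (intro tendsto_lowerbound[of _ _ sequentially]) auto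
qed (use assms in auto)

subsection \<open>A priori estimates for perturbed solutions\<close>

lemma abs_add_diff_le:
  fixes u v w :: real
  assumes "\<bar>u\<bar> \<le> F" "\<bar>v\<bar> \<le> G" "\<bar>w\<bar> \<le> H"
  shows "\<bar>u + v - w\<bar> \<le> F + G + H"
  using abs_triangle_ineq4[of "u + v" w] abs_triangle_ineq[of u v] assms by linarith

text \<open>Here \<open>b j\<close>, \<open>c j\<close> and \<open>A\<close> abstract the essential
  norms of \<open>a j\<close>, of the quotient of \<open>a j\<close> by the sum over \<Omega>, and
  of the full sum; the quotient bound is stated without division. One null set \<open>N\<close>
  collects all exceptional points, so every estimate becomes pointwise outside it.\<close>

locale delay_coefficients =
  fixes J \<Omega> :: "nat set" and a h :: "nat \<Rightarrow> real \<Rightarrow> real" and \<tau> b c :: "nat \<Rightarrow> real"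
    and \<alpha> A t0 :: real and N :: "real set"
  assumes fin: "finite J" and sub: "\<Omega> \<subseteq> J" and neg: "negligible N"
    and \<alpha>_pos: "\<alpha> > 0" and A_nonneg: "A \<ge> 0"
    and nonneg: "\<And>j. j \<in> J \<Longrightarrow> \<tau> j \<ge> 0 \<and> b j \<ge> 0 \<and> c j \<ge> 0"
    and a_le: "\<And>t j. \<lbrakk>t \<in> {t0..} - N; j \<in> J\<rbrakk> \<Longrightarrow> \<bar>a j t\<bar> \<le> b j"
    and a_le_dominant: "\<And>t j. \<lbrakk>t \<in> {t0..} - N; j \<in> J\<rbrakk> \<Longrightarrow> \<bar>a j t\<bar> \<le> c j * (\<Sum>i\<in>\<Omega>. a i t)"
    and delay: "\<And>t j. \<lbrakk>t \<in> {t0..} - N; j \<in> J\<rbrakk> \<Longrightarrow> h j t \<le> t \<and> t - h j t \<le> \<tau> j"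
    and \<alpha>_le: "\<And>t. t \<in> {t0..} - N \<Longrightarrow> \<alpha> \<le> (\<Sum>j\<in>\<Omega>. a j t)"
    and sum_le: "\<And>t. t \<in> {t0..} - N \<Longrightarrow> \<bar>\<Sum>j\<in>J. a j t\<bar> \<le> A"

text \<open>The constant \<open>F\<close> absorbs the error made when a solution is multiplied by a slowly growing
  exponential, so that boundedness of perturbed solutions yields decay of solutions.\<close>

locale perturbed_solution = delay_coefficients +
  fixes s T \<Psi> m F :: real and y :: "real \<Rightarrow> real" and M :: "real set"
  assumes t0_le: "t0 \<le> s" and negM: "negligible M" and \<Psi>_nonneg: "0 \<le> \<Psi>" and F_nonneg: "0 \<le> F"
    and ac: "abs_continuous_on_interval s T y"
    and initial: "\<And>t. t \<le> s \<Longrightarrow> \<bar>y t\<bar> \<le> \<Psi>"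
    and bound: "\<And>t. t \<le> T \<Longrightarrow> \<bar>y t\<bar> \<le> m"
    and ode: "\<And>t. t \<in> {s..T} - M \<Longrightarrow>
      \<exists>D. (y has_real_derivative D) (at t) \<and> \<bar>D + (\<Sum>j\<in>J. a j t * y (h j t))\<bar> \<le> F"
begin

lemma m_nonneg: "0 \<le> m"
  using bound[of T] by simp

lemma coeff_sums_nonneg: "0 \<le> (\<Sum>j\<in>J. b j)" "0 \<le> (\<Sum>j\<in>J. \<tau> j * b j)"
  using nonneg by (auto intro!: sum_nonneg)

lemma regular: "t \<in> {s..T} - (N \<union> M) \<Longrightarrow> t \<in> {t0..} - N"
  using t0_le by auto

text \<open>If the delayed argument precedes \<open>s\<close>, the comparison goes through
  \<open>y s\<close>: the Lipschitz bound covers the part after \<open>s\<close>, and two values of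
  the initial function cost at most \<open>2 * \<Psi>\<close>.\<close>

lemma delayed_difference:
  assumes D: "D-lipschitz_on {s..T} y" and t: "t \<in> {s..T} - (N \<union> M)" and j: "j \<in> J"
  shows "\<bar>y t - y (h j t)\<bar> \<le> D * \<tau> j + 2 * \<Psi>"
proof -
  have h: "h j t \<le> t" "t - h j t \<le> \<tau> j" and "D \<ge> 0"
    using delay[OF regular[OF t] j] lipschitz_on_nonneg[OF D] by auto
  have *: "\<bar>y t - y u\<bar> \<le> D * \<tau> j" if "s \<le> u" "h j t \<le> u" "u \<le> t" for u
  proof -
    have "\<bar>y t - y u\<bar> \<le> D * (t - u)"
      using lipschitz_onD[OF D, of t u] t that by (simp add: dist_real_def)
    also have "\<dots> \<le> D * \<tau> j" using that h \<open>D \<ge> 0\<close> by (intro mult_left_mono) auto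
    finally show ?thesis .
  qed
  show ?thesis
  proof (cases "s \<le> h j t")
    case True
    with *[of "h j t"] h \<Psi>_nonneg show ?thesis by simp
  next
    case False
    then have "\<bar>(y t - y s) + y s - y (h j t)\<bar> \<le> D * \<tau> j + \<Psi> + \<Psi>"
      using t by (intro abs_add_diff_le * initial) auto
    then show ?thesis by simp
  qed
qed

text \<open>The weights stay general because two choices occur: the constants \<open>b j\<close>,
  and \<open>c j\<close> times the value at \<open>t\<close> of the coefficient sum over
  \<Omega>.\<close>

lemma weighted_delayed_difference:
  assumes "D-lipschitz_on {s..T} y" "t \<in> {s..T} - (N \<union> M)" "I \<subseteq> J"
    and w: "\<And>j. j \<in> I \<Longrightarrow> \<bar>a j t\<bar> \<le> w j"
  shows "\<bar>\<Sum>j\<in>I. a j t * (y t - y (h j t))\<bar> \<le> (\<Sum>j\<in>I. \<tau> j * w j) * D + 2 * \<Psi> * (\<Sum>j\<in>I. w j)"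
proof -
  have "\<bar>\<Sum>j\<in>I. a j t * (y t - y (h j t))\<bar> \<le> (\<Sum>j\<in>I. \<bar>a j t\<bar> * \<bar>y t - y (h j t)\<bar>)"
    by (rule order_trans[OF sum_abs]) (simp add: abs_mult)
  also have "\<dots> \<le> (\<Sum>j\<in>I. w j * (D * \<tau> j + 2 * \<Psi>))"
    using assms by (intro sum_mono mult_mono w delayed_difference) (auto intro: order_trans[OF _ w])
  also have "\<dots> = (\<Sum>j\<in>I. \<tau> j * w j) * D + 2 * \<Psi> * (\<Sum>j\<in>I. w j)"
    by (simp add: sum_distrib_left sum_distrib_right sum.distrib algebra_simps)
  finally show ?thesis .
qed

lemma weighted_delayed_value:
  assumes "t \<in> {s..T} - (N \<union> M)" "I \<subseteq> J" and w: "\<And>j. j \<in> I \<Longrightarrow> \<bar>a j t\<bar> \<le> w j"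
  shows "\<bar>\<Sum>j\<in>I. a j t * y (h j t)\<bar> \<le> (\<Sum>j\<in>I. w j) * m"
proof -
  have "\<bar>\<Sum>j\<in>I. a j t * y (h j t)\<bar> \<le> (\<Sum>j\<in>I. \<bar>a j t\<bar> * \<bar>y (h j t)\<bar>)"
    by (rule order_trans[OF sum_abs]) (simp add: abs_mult)
  also have "\<dots> \<le> (\<Sum>j\<in>I. w j * m)"
  proof (intro sum_mono mult_mono w bound)
    fix j assume "j \<in> I"
    then show "h j t \<le> T" "0 \<le> w j" using delay[OF regular[OF assms(1)], of j] assms(1,2) w[of j] by auto
  qed auto
  finally show ?thesis by (simp add: sum_distrib_right)
qed

text \<open>Read off the equation by bounding every delayed value by \<open>m\<close>. This constant
  serves case (a) directly and starts the iteration in case (b).\<close>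

lemma lipschitz_crude: "((\<Sum>j\<in>J. b j) * m + F)-lipschitz_on {s..T} y"
proof (rule abs_continuous_lipschitz[OF ac])
  show "0 \<le> (\<Sum>j\<in>J. b j) * m + F"
    using coeff_sums_nonneg F_nonneg m_nonneg by simp
  show "negligible (N \<union> M)" using neg negM by simp
  fix t assume t: "t \<in> {s..T} - (N \<union> M)"
  obtain D where D: "(y has_real_derivative D) (at t)" "\<bar>D + (\<Sum>j\<in>J. a j t * y (h j t))\<bar> \<le> F"
    using ode[of t] t by auto
  have "\<bar>\<Sum>j\<in>J. a j t * y (h j t)\<bar> \<le> (\<Sum>j\<in>J. b j) * m"
    using a_le[OF regular[OF t]] by (intro weighted_delayed_value t) auto
  with D show "\<exists>y'. (y has_real_derivative y') (at t) \<and> \<bar>y'\<bar> \<le> (\<Sum>j\<in>J. b j) * m + F"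
    by (intro exI[of _ D]) auto
qed

text \<open>Replacing \<open>y (h j t)\<close> by \<open>y t\<close> minus a delayed difference lets
  the coefficients cancel in their sum: \<open>m\<close> is multiplied by \<open>A\<close> instead
  of the sum of the \<open>b j\<close>, at the price of a multiple of the old constant
  \<open>D\<close>.\<close>

lemma lipschitz_refine:
  assumes L: "D-lipschitz_on {s..T} y"
  shows "((\<Sum>j\<in>J. \<tau> j * b j) * D + (A * m + F + 2 * \<Psi> * (\<Sum>j\<in>J. b j)))-lipschitz_on {s..T} y"
    (is "?E-lipschitz_on _ _")
proof (rule abs_continuous_lipschitz[OF ac])
  show "0 \<le> ?E"
    using coeff_sums_nonneg F_nonneg m_nonneg A_nonneg \<Psi>_nonneg lipschitz_on_nonneg[OF L] by simp
  show "negligible (N \<union> M)" using neg negM by simp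
  fix t assume t: "t \<in> {s..T} - (N \<union> M)"
  obtain D' where D': "(y has_real_derivative D') (at t)" "\<bar>D' + (\<Sum>j\<in>J. a j t * y (h j t))\<bar> \<le> F"
    using ode[of t] t by auto
  have 1: "\<bar>\<Sum>j\<in>J. a j t * (y t - y (h j t))\<bar> \<le> (\<Sum>j\<in>J. \<tau> j * b j) * D + 2 * \<Psi> * (\<Sum>j\<in>J. b j)"
    using a_le[OF regular[OF t]] by (intro weighted_delayed_difference L t) auto
  have 2: "\<bar>(\<Sum>j\<in>J. a j t) * y t\<bar> \<le> A * m"
    unfolding abs_mult using sum_le[OF regular[OF t]] bound[of t] A_nonneg t by (intro mult_mono) auto
  have "D' = (D' + (\<Sum>j\<in>J. a j t * y (h j t))) + (\<Sum>j\<in>J. a j t * (y t - y (h j t))) - (\<Sum>j\<in>J. a j t) * y t"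
    by (simp add: sum_subtractf right_diff_distrib sum_distrib_right)
  then have "\<bar>D'\<bar> \<le> ?E"
    using abs_add_diff_le[OF D'(2) 1 2] by (simp only: ac_simps)
  with D'(1) show "\<exists>y'. (y has_real_derivative y') (at t) \<and> \<bar>y'\<bar> \<le> ?E"
    by blast
qed

text \<open>With \<open>A'\<close> the coefficient sum over \<Omega>, the equation gives a bound
  \<open>A' * B\<close> for \<open>D' + A' * y t\<close>. Hence \<open>y\<close> decreases wherever
  it exceeds \<open>B\<close> and increases wherever it is below \<open>- B\<close>, so both levels
  are barriers.\<close>

lemma value_estimate:
  assumes L: "D-lipschitz_on {s..T} y" and t: "t \<in> {s..T}"
  shows "\<bar>y t\<bar> \<le> (\<Sum>j\<in>\<Omega>. \<tau> j * c j) * D + (\<Sum>j\<in>J - \<Omega>. c j) * m + F / \<alpha> + (1 + 2 * (\<Sum>j\<in>\<Omega>. c j)) * \<Psi>"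
proof -
  define p q r where "p = (\<Sum>j\<in>\<Omega>. \<tau> j * c j)" and "q = (\<Sum>j\<in>J - \<Omega>. c j)" and "r = (\<Sum>j\<in>\<Omega>. c j)"
  define B where "B = p * D + q * m + F / \<alpha> + (1 + 2 * r) * \<Psi>"
  have "0 \<le> p" "0 \<le> q" "0 \<le> r"
    unfolding p_def q_def r_def using nonneg sub by (auto intro!: sum_nonneg)
  then have "0 \<le> p * D" "0 \<le> q * m" "0 \<le> 2 * r * \<Psi>" "0 \<le> F / \<alpha>"
    using m_nonneg F_nonneg \<alpha>_pos \<Psi>_nonneg lipschitz_on_nonneg[OF L] by simp_all
  then have B: "\<Psi> \<le> B" unfolding B_def distrib_right by linarith
  have key: "\<exists>A' D'. A' > 0 \<and> (y has_real_derivative D') (at t) \<and> \<bar>D' + A' * y t\<bar> \<le> A' * B"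
    if t: "t \<in> {s..T} - (N \<union> M)" for t
  proof -
    define A' where "A' = (\<Sum>j\<in>\<Omega>. a j t)"
    have A': "\<alpha> \<le> A'" using \<alpha>_le[OF regular[OF t]] by (simp add: A'_def)
    have aw: "\<bar>a j t\<bar> \<le> c j * A'" if "j \<in> J" for j
      using a_le_dominant[OF regular[OF t] that] by (simp add: A'_def)
    obtain D' where D': "(y has_real_derivative D') (at t)" "\<bar>D' + (\<Sum>j\<in>J. a j t * y (h j t))\<bar> \<le> F"
      using ode[of t] t by auto
    have "\<bar>\<Sum>j\<in>\<Omega>. a j t * (y t - y (h j t))\<bar>
        \<le> (\<Sum>j\<in>\<Omega>. \<tau> j * (c j * A')) * D + 2 * \<Psi> * (\<Sum>j\<in>\<Omega>. c j * A')"
      using sub by (intro weighted_delayed_difference L t aw) auto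
    also have "\<dots> = A' * (p * D) + A' * (2 * r * \<Psi>)"
      unfolding p_def r_def by (simp add: sum_distrib_right[symmetric] mult.assoc[symmetric])
    finally have 1: "\<bar>\<Sum>j\<in>\<Omega>. a j t * (y t - y (h j t))\<bar> \<le> A' * (p * D) + A' * (2 * r * \<Psi>)" .
    have "\<bar>\<Sum>j\<in>J - \<Omega>. a j t * y (h j t)\<bar> \<le> (\<Sum>j\<in>J - \<Omega>. c j * A') * m"
      by (intro weighted_delayed_value t aw) auto
    also have "\<dots> = A' * (q * m)"
      unfolding q_def by (simp add: sum_distrib_right[symmetric])
    finally have 2: "\<bar>\<Sum>j\<in>J - \<Omega>. a j t * y (h j t)\<bar> \<le> A' * (q * m)" .
    \<comment> \<open>Unlike the other terms, \<open>F\<close> carries no factor \<open>A'\<close>;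
      the lower bound \<alpha> supplies it.\<close>
    have 3: "F \<le> A' * (F / \<alpha>)"
      using mult_right_mono[OF A', of "F / \<alpha>"] \<alpha>_pos F_nonneg by simp
    \<comment> \<open>The extra \<Psi> in \<open>B\<close> serves to put the initial value below the
      barrier; in this estimate it is just a nonnegative surplus.\<close>
    have 4: "0 \<le> A' * \<Psi>" using A' \<alpha>_pos \<Psi>_nonneg by simp
    have split: "(\<Sum>j\<in>J. a j t * y (h j t)) = (\<Sum>j\<in>J - \<Omega>. a j t * y (h j t)) + (\<Sum>j\<in>\<Omega>. a j t * y (h j t))"
      using sub fin by (rule sum.subset_diff)
    have "D' + A' * y t = (D' + (\<Sum>j\<in>J. a j t * y (h j t))) + (\<Sum>j\<in>\<Omega>. a j t * (y t - y (h j t)))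
        - (\<Sum>j\<in>J - \<Omega>. a j t * y (h j t))"
      unfolding split A'_def by (simp add: sum_subtractf right_diff_distrib sum_distrib_right)
    then have "\<bar>D' + A' * y t\<bar> \<le> F + (A' * (p * D) + A' * (2 * r * \<Psi>)) + A' * (q * m)"
      using abs_add_diff_le[OF D'(2) 1 2] by (simp only:)
    moreover have "A' * B = A' * (p * D) + A' * (q * m) + A' * (F / \<alpha>) + (A' * \<Psi> + A' * (2 * r * \<Psi>))"
      unfolding B_def by (simp only: distrib_left distrib_right mult_1)
    ultimately have "\<bar>D' + A' * y t\<bar> \<le> A' * B"
      using 3 4 by linarith
    moreover have "A' > 0" using A' \<alpha>_pos by simp
    ultimately show ?thesis using D'(1) by blast
  qed
  have "y t \<le> B"
  proof (rule abs_continuous_le_barrier[OF ac _ _ _ t])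
    fix t assume "t \<in> {s..T} - (N \<union> M)" "y t > B"
    with key[of t] obtain A' D' where *: "A' > 0" "(y has_real_derivative D') (at t)" "\<bar>D' + A' * y t\<bar> \<le> A' * B"
      by blast
    then have "D' \<le> 0" using mult_strict_left_mono[OF \<open>y t > B\<close> *(1)] by linarith
    with * show "\<exists>D\<le>0. (y has_real_derivative D) (at t)" by blast
  qed (use initial[of s] B neg negM in auto)
  moreover have "- y t \<le> B"
  proof (rule abs_continuous_le_barrier[OF abs_continuous_on_interval_uminus[OF ac] _ _ _ t])
    fix t assume "t \<in> {s..T} - (N \<union> M)" "- y t > B"
    with key[of t] obtain A' D' where *: "A' > 0" "(y has_real_derivative D') (at t)" "\<bar>D' + A' * y t\<bar> \<le> A' * B"
      by blast
    then have "- D' \<le> 0" using mult_strict_left_mono[OF \<open>- y t > B\<close> *(1)] by linarith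
    with DERIV_minus[OF *(2)] show "\<exists>D\<le>0. ((\<lambda>t. - y t) has_real_derivative D) (at t)"
      by blast
  qed (use initial[of s] B neg negM in auto)
  ultimately show ?thesis unfolding B_def p_def q_def r_def by linarith
qed

text \<open>The version for case (a): the coefficient of \<open>m\<close> is the left-hand side of
  the second inequality there.\<close>

lemma value_estimate_crude:
  assumes "t \<in> {s..T}"
  shows "\<bar>y t\<bar> \<le> ((\<Sum>j\<in>J. b j) * (\<Sum>j\<in>\<Omega>. \<tau> j * c j) + (\<Sum>j\<in>J - \<Omega>. c j)) * m
    + ((\<Sum>j\<in>\<Omega>. \<tau> j * c j) + 1 / \<alpha>) * F + (1 + 2 * (\<Sum>j\<in>\<Omega>. c j)) * \<Psi>"
  using value_estimate[OF lipschitz_crude assms] by (simp add: algebra_simps)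

text \<open>The version for case (b): \<open>D\<close> is the fixed point of the refinement step,
  whence the division by \<open>1 - (\<Sum>j\<in>J. \<tau> j * b j)\<close>.\<close>

lemma value_estimate_refined:
  assumes "t \<in> {s..T}" and K: "(\<Sum>j\<in>J. \<tau> j * b j) < 1"
  defines "p \<equiv> (\<Sum>j\<in>\<Omega>. \<tau> j * c j) / (1 - (\<Sum>j\<in>J. \<tau> j * b j))"
  shows "\<bar>y t\<bar> \<le> (A * p + (\<Sum>j\<in>J - \<Omega>. c j)) * m
    + (p + 1 / \<alpha>) * F + (1 + 2 * (\<Sum>j\<in>\<Omega>. c j) + 2 * p * (\<Sum>j\<in>J. b j)) * \<Psi>"
proof -
  have "((A * m + F + 2 * \<Psi> * (\<Sum>j\<in>J. b j)) / (1 - (\<Sum>j\<in>J. \<tau> j * b j)))-lipschitz_on {s..T} y"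
    using coeff_sums_nonneg F_nonneg m_nonneg A_nonneg \<Psi>_nonneg
    by (intro lipschitz_on_fixed_bound[OF _ K _ lipschitz_crude] lipschitz_refine) simp_all
  from value_estimate[OF this assms(1)] show ?thesis
    by (simp add: p_def algebra_simps add_divide_distrib)
qed

end

subsection \<open>Exponential stability\<close>

lemma AE_lebesgue_on_atLeast_negligible:
  fixes c :: real
  assumes "AE t in lebesgue_on {c..}. P t"
  obtains N where "negligible N" "\<And>t. t \<in> {c..} - N \<Longrightarrow> P t"
proof -
  have "AE t in lebesgue. t \<in> {c..} \<longrightarrow> P t"
    using assms by (subst (asm) AE_restrict_space_iff) auto
  then obtain N where "N \<in> null_sets lebesgue" "\<And>t. t \<notin> N \<Longrightarrow> t \<in> {c..} \<longrightarrow> P t"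
    by (elim AE_E3) auto
  then show ?thesis using that by (auto simp: negligible_iff_null_sets)
qed

lemma not_negligible_atLeast: "\<not> negligible {c::real..}"
proof
  assume "negligible {c..}"
  then have "negligible (cbox c (c + 1))" by (rule negligible_subset) auto
  then show False unfolding negligible_interval by simp
qed

text \<open>Essential boundedness excludes an infinite supremum, which \<open>real_of_ereal\<close>
  would turn into 0.\<close>

lemma AE_abs_le_ess_norm:
  assumes "ess_bounded_from t0 y"
  shows "AE t in lebesgue_on {t0..}. \<bar>y t\<bar> \<le> ess_norm t0 y"
  using esssup_AE[of "\<lambda>t. ereal \<bar>y t\<bar>" "lebesgue_on {t0..}"]
proof eventually_elim
  case (elim t)
  with assms show ?case unfolding ess_bounded_from_def ess_norm_def
    by (cases "esssup (lebesgue_on {t0..}) (\<lambda>t. ereal \<bar>y t\<bar>)") auto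
qed

lemma ess_bounded_fromI:
  assumes "y \<in> borel_measurable (lebesgue_on {t0..})" "AE t in lebesgue_on {t0..}. \<bar>y t\<bar> \<le> C"
  shows "ess_bounded_from t0 y"
proof -
  have "esssup (lebesgue_on {t0..}) (\<lambda>t. ereal \<bar>y t\<bar>) \<le> ereal C"
    using assms by (intro esssup_I) auto
  then show ?thesis unfolding ess_bounded_from_def by (rule le_less_trans) simp
qed

section \<open>Exponential weights and the stability proof\<close>

lemma exp_lipschitz_on:
  fixes \<nu> s T :: real
  assumes "\<nu> \<ge> 0"
  shows "(\<nu> * exp (\<nu> * (T - s)))-lipschitz_on {s..T} (\<lambda>t. exp (\<nu> * (t - s)))"
proof (rule lipschitz_onI)
  have *: "\<bar>exp (\<nu> * (v - s)) - exp (\<nu> * (u - s))\<bar> \<le> \<nu> * exp (\<nu> * (T - s)) * (v - u)"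
    if "u \<le> v" "v \<le> T" for u v
  proof -
    have "exp (\<nu> * (v - s)) - exp (\<nu> * (u - s)) = exp (\<nu> * (v - s)) * (1 - exp (- (\<nu> * (v - u))))"
      by (simp add: right_diff_distrib flip: exp_add)
    also have "\<dots> \<le> exp (\<nu> * (T - s)) * (\<nu> * (v - u))"
    proof (rule mult_mono)
      show "1 - exp (- (\<nu> * (v - u))) \<le> \<nu> * (v - u)"
        using exp_ge_add_one_self[of "- (\<nu> * (v - u))"] by linarith
    qed (use that assms in \<open>auto intro!: mult_left_mono\<close>)
    moreover have "exp (\<nu> * (u - s)) \<le> exp (\<nu> * (v - s))"
      using that assms by (auto intro!: mult_left_mono)
    ultimately show ?thesis by (simp only: abs_of_nonneg diff_ge_0_iff_ge mult_ac)
  qed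
  show "dist (exp (\<nu> * (u - s))) (exp (\<nu> * (v - s))) \<le> \<nu> * exp (\<nu> * (T - s)) * dist u v"
    if "u \<in> {s..T}" "v \<in> {s..T}" for u v
    using *[of u v] *[of v u] that by (cases "u \<le> v") (auto simp: dist_real_def abs_minus_commute)
qed (use assms in simp)

text \<open>The estimate is applied to the solution multiplied by a growing exponential of rate
  \<nu>. The resulting perturbation is a small multiple of \<open>m\<close>, absorbed by the gap
  between \<theta> and 1. As \<theta>, \<open>G\<close> and \<open>H\<close> do not depend on
  \<open>s\<close> or \<open>T\<close>, neither do the final constants.\<close>

lemma (in delay_coefficients) exponential_stability_if_estimate:
  assumes J: "J = {1..n}" and \<theta>: "\<theta> < 1" and GH: "G \<ge> 0" "H \<ge> 0"
    and est: "\<And>s T \<Psi> m F y M t. \<lbrakk>perturbed_solution J \<Omega> a h \<tau> b c \<alpha> A t0 N s T \<Psi> m F y M; t \<in> {s..T}\<rbrakk>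
      \<Longrightarrow> \<bar>y t\<bar> \<le> \<theta> * m + G * F + H * \<Psi>"
  shows "uniformly_exponentially_stable t0 n a h"
proof -
  \<comment> \<open>The first term comes from differentiating the weight, the sum from the growth of
    the weight over one delay. The whole tends to 0 with \<nu>.\<close>
  define \<epsilon> where "\<epsilon> \<nu> = \<nu> + (\<Sum>j\<in>J. b j * (exp (\<nu> * \<tau> j) - 1))" for \<nu>
  have "((\<lambda>\<nu>. G * \<epsilon> \<nu>) \<longlongrightarrow> G * (0 + (\<Sum>j\<in>J. b j * (exp (0 * \<tau> j) - 1)))) (at_right 0)"
    unfolding \<epsilon>_def by (intro tendsto_intros)
  \<comment> \<open>Half of the gap absorbs the perturbation; the other half remains as the
    coefficient of \<open>m\<close>.\<close>
  then have "\<forall>\<^sub>F \<nu> in at_right 0. G * \<epsilon> \<nu> < (1 - \<theta>) / 2"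
    by (rule order_tendstoD) (use \<theta> in simp)
  then have "\<forall>\<^sub>F \<nu> in at_right 0. \<nu> > 0 \<and> G * \<epsilon> \<nu> < (1 - \<theta>) / 2"
    using eventually_at_right_less by eventually_elim simp
  then obtain \<nu> where \<nu>: "\<nu> > 0" and G\<epsilon>: "G * \<epsilon> \<nu> < (1 - \<theta>) / 2"
    using eventually_happens' trivial_limit_at_right_real by blast
  have \<epsilon>_nonneg: "\<epsilon> \<nu> \<ge> 0"
    using \<nu> nonneg unfolding \<epsilon>_def by (intro add_nonneg_nonneg sum_nonneg mult_nonneg_nonneg) auto
  define C where "C = max 1 (2 * H / (1 - \<theta>))"
  have "\<bar>x t\<bar> \<le> C * exp (- \<nu> * (t - s)) * (SUP \<theta>\<in>{..s}. \<bar>\<psi> \<theta>\<bar>)"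
    if s: "s \<ge> t0" and init: "initial_function s \<psi>" and sol: "is_solution n a h s \<psi> x" and t: "t \<ge> s"
    for s \<psi> x t
  proof -
    define \<Psi> where "\<Psi> = (SUP \<theta>\<in>{..s}. \<bar>\<psi> \<theta>\<bar>)"
    have "bdd_above ((\<lambda>\<theta>. \<bar>\<psi> \<theta>\<bar>) ` {..s})"
      using init unfolding initial_function_def bounded_iff by (auto simp: bdd_above_def)
    then have \<psi>_le: "\<bar>\<psi> r\<bar> \<le> \<Psi>" if "r \<le> s" for r
      using that unfolding \<Psi>_def by (intro cSUP_upper) auto
    have \<Psi>_nonneg: "\<Psi> \<ge> 0" using \<psi>_le[of s] by simp
    from sol have x_init: "\<And>r. r \<le> s \<Longrightarrow> x r = \<psi> r" and ac_x: "abs_continuous_on_interval s t x"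
      and "AE r in lebesgue_on {s..}. x differentiable (at r) \<and> deriv x r + (\<Sum>j=1..n. a j r * x (h j r)) = 0"
      using t unfolding is_solution_def by auto
    from AE_lebesgue_on_atLeast_negligible[OF this(3)] obtain M where "negligible M" and M:
      "\<And>r. r \<in> {s..} - M \<Longrightarrow> x differentiable (at r) \<and> deriv x r + (\<Sum>j\<in>J. a j r * x (h j r)) = 0"
      unfolding J by blast
    define y where "y r = exp (\<nu> * (r - s)) * x r" for r
    have ac_y: "abs_continuous_on_interval s t y"
      unfolding y_def using \<nu>
      by (intro abs_continuous_on_interval_lipschitz_mult[OF ac_x exp_lipschitz_on]) auto
    have y_init: "\<bar>y r\<bar> \<le> \<Psi>" if "r \<le> s" for r
    proof -
      have "exp (\<nu> * (r - s)) * \<bar>x r\<bar> \<le> 1 * \<Psi>"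
        using that \<nu> \<psi>_le[OF that] x_init[OF that] by (intro mult_mono) (auto simp: mult_nonneg_nonpos)
      then show ?thesis by (simp add: y_def abs_mult)
    qed
    have "continuous_on {s..t} (\<lambda>r. \<bar>y r\<bar>)"
      using abs_continuous_on_interval_imp_continuous_on[OF ac_y] by (rule continuous_on_rabs)
    from continuous_attains_sup[OF _ _ this] t obtain r0
      where r0: "r0 \<in> {s..t}" "\<And>r. r \<in> {s..t} \<Longrightarrow> \<bar>y r\<bar> \<le> \<bar>y r0\<bar>"
      by auto
    \<comment> \<open>The bound is attained, either by \<Psi> or at \<open>r0\<close>, so estimating
      \<open>y\<close> at the single point \<open>r0\<close> bounds \<open>m\<close> itself.\<close>
    define m where "m = max \<Psi> \<bar>y r0\<bar>"
    have y_le: "\<bar>y r\<bar> \<le> m" if "r \<le> t" for r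
      using that r0(2)[of r] y_init[of r] by (cases "r \<le> s") (auto simp: m_def)
    have "m \<ge> 0" by (simp add: m_def)
    have sol_y: "perturbed_solution J \<Omega> a h \<tau> b c \<alpha> A t0 N s t \<Psi> m (\<epsilon> \<nu> * m) y (N \<union> M)"
    proof unfold_locales
      fix r assume r: "r \<in> {s..t} - (N \<union> M)"
      define D where "D = \<nu> * y r + exp (\<nu> * (r - s)) * deriv x r"
      have "(x has_real_derivative deriv x r) (at r)"
        using M[of r] r by (simp add: DERIV_deriv_iff_real_differentiable)
      then have D: "(y has_real_derivative D) (at r)"
        unfolding y_def D_def by (auto intro!: derivative_eq_intros)
      have "deriv x r = - (\<Sum>j\<in>J. a j r * x (h j r))" using M[of r] r by (simp add: eq_neg_iff_add_eq_0)
      then have "D = \<nu> * y r - (\<Sum>j\<in>J. a j r * (exp (\<nu> * (r - s)) * x (h j r)))"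
        unfolding D_def by (simp add: sum_distrib_left mult_ac)
      \<comment> \<open>Since \<open>y\<close> is defined on the whole line, this also holds when
        \<open>h j r\<close> lies before \<open>s\<close>.\<close>
      also have "\<dots> = \<nu> * y r - (\<Sum>j\<in>J. a j r * (exp (\<nu> * (r - h j r)) * y (h j r)))"
        unfolding y_def by (simp add: mult.assoc[symmetric] right_diff_distrib flip: exp_add)
      finally have eq: "D + (\<Sum>j\<in>J. a j r * y (h j r))
          = \<nu> * y r - (\<Sum>j\<in>J. a j r * (exp (\<nu> * (r - h j r)) - 1) * y (h j r))"
        by (simp add: sum_subtractf algebra_simps)
      have "\<bar>\<Sum>j\<in>J. a j r * (exp (\<nu> * (r - h j r)) - 1) * y (h j r)\<bar>
          \<le> (\<Sum>j\<in>J. b j * (exp (\<nu> * \<tau> j) - 1) * m)"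
      proof (rule order_trans[OF sum_abs], rule sum_mono)
        fix j assume j: "j \<in> J"
        have rr: "r \<in> {t0..} - N" using r s by auto
        have "0 \<le> \<nu> * (r - h j r)" "\<nu> * (r - h j r) \<le> \<nu> * \<tau> j"
          using delay[OF rr j] \<nu> by (auto intro: mult_left_mono)
        then have "\<bar>exp (\<nu> * (r - h j r)) - 1\<bar> \<le> exp (\<nu> * \<tau> j) - 1" by simp
        then show "\<bar>a j r * (exp (\<nu> * (r - h j r)) - 1) * y (h j r)\<bar> \<le> b j * (exp (\<nu> * \<tau> j) - 1) * m"
          using a_le[OF rr j] y_le[of "h j r"] delay[OF rr j] r nonneg[OF j] \<nu>
          unfolding abs_mult by (intro mult_mono mult_nonneg_nonneg abs_ge_zero) simp_all
      qed
      moreover have "\<bar>\<nu> * y r\<bar> \<le> \<nu> * m" using y_le[of r] r \<nu> by (simp add: abs_mult)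
      ultimately have "\<bar>D + (\<Sum>j\<in>J. a j r * y (h j r))\<bar> \<le> \<epsilon> \<nu> * m"
        unfolding eq \<epsilon>_def by (simp add: distrib_right sum_distrib_right)
      with D show "\<exists>D. (y has_real_derivative D) (at r) \<and> \<bar>D + (\<Sum>j\<in>J. a j r * y (h j r))\<bar> \<le> \<epsilon> \<nu> * m"
        by blast
    qed (use s \<open>negligible M\<close> neg \<Psi>_nonneg \<epsilon>_nonneg \<open>m \<ge> 0\<close> ac_y y_init y_le in auto)
    have "\<bar>y r0\<bar> \<le> \<theta> * m + G * (\<epsilon> \<nu> * m) + H * \<Psi>"
      by (rule est[OF sol_y r0(1)])
    also have "G * (\<epsilon> \<nu> * m) \<le> (1 - \<theta>) / 2 * m"
      using mult_right_mono[OF less_imp_le[OF G\<epsilon>] \<open>m \<ge> 0\<close>] by (simp add: mult.assoc)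
    finally have "\<bar>y r0\<bar> \<le> m - (1 - \<theta>) / 2 * m + H * \<Psi>"
      by (simp add: field_simps)
    \<comment> \<open>Either the maximum is \<Psi>, or \<open>m\<close> equals the value at
      \<open>r0\<close> and can be moved to the left-hand side. The two alternatives explain the
      maximum in \<open>C\<close>.\<close>
    then have "m \<le> \<Psi> \<or> (1 - \<theta>) * m \<le> 2 * H * \<Psi>" unfolding m_def by (auto simp: max_def field_simps)
    then have "m \<le> C * \<Psi>"
    proof
      assume "m \<le> \<Psi>"
      also have "\<Psi> \<le> C * \<Psi>" using mult_right_mono[of 1 C \<Psi>] \<Psi>_nonneg by (simp add: C_def)
      finally show ?thesis .
    next
      assume "(1 - \<theta>) * m \<le> 2 * H * \<Psi>"
      then have "m \<le> 2 * H / (1 - \<theta>) * \<Psi>" using \<theta> by (simp add: field_simps)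
      also have "\<dots> \<le> C * \<Psi>" using \<Psi>_nonneg by (intro mult_right_mono) (auto simp: C_def)
      finally show ?thesis .
    qed
    then have "\<bar>y t\<bar> \<le> C * \<Psi>" using y_le[of t] by simp
    then have "exp (- \<nu> * (t - s)) * \<bar>y t\<bar> \<le> exp (- \<nu> * (t - s)) * (C * \<Psi>)" by simp
    moreover have "exp (- \<nu> * (t - s)) * \<bar>y t\<bar> = \<bar>x t\<bar>"
      unfolding y_def abs_mult by (simp add: mult.assoc[symmetric] flip: exp_add)
    ultimately show ?thesis unfolding \<Psi>_def by (simp only: mult_ac)
  qed
  moreover have "C > 0" by (simp add: C_def)
  ultimately show ?thesis using \<nu> unfolding uniformly_exponentially_stable_def by blast
qed

text \<open>Finitely many almost-everywhere conditions share one null set. The sum and the quotients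
  need essential bounds of their own, obtained from the sum of the \<open>b j\<close> and from
  \<open>b j / \<alpha>\<close>.\<close>

lemma delay_coefficients_ess_norm:
  fixes t0 \<alpha> :: real and J \<Omega> :: "nat set" and a h :: "nat \<Rightarrow> real \<Rightarrow> real" and \<tau> :: "nat \<Rightarrow> real"
  defines "A \<equiv> \<lambda>t. \<Sum>j\<in>J. a j t" and "A\<^sub>\<Omega> \<equiv> \<lambda>t. \<Sum>j\<in>\<Omega>. a j t"
  assumes J: "finite J" and \<Omega>: "\<Omega> \<subseteq> J"
    and meas: "\<And>j. j \<in> J \<Longrightarrow> a j \<in> borel_measurable (lebesgue_on {t0..})"
    and bdd: "\<And>j. j \<in> J \<Longrightarrow> ess_bounded_from t0 (a j)"
    and \<tau>: "\<And>j. j \<in> J \<Longrightarrow> \<tau> j \<ge> 0"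
    and h: "\<And>j. j \<in> J \<Longrightarrow> AE t in lebesgue_on {t0..}. 0 \<le> t - h j t \<and> t - h j t \<le> \<tau> j"
    and "\<alpha> > 0" and \<alpha>_le: "AE t in lebesgue_on {t0..}. A\<^sub>\<Omega> t \<ge> \<alpha>"
  obtains N where "delay_coefficients J \<Omega> a h \<tau> (\<lambda>j. ess_norm t0 (a j))
    (\<lambda>j. ess_norm t0 (\<lambda>t. a j t / A\<^sub>\<Omega> t)) \<alpha> (ess_norm t0 A) t0 N"
proof -
  define b where "b j = ess_norm t0 (a j)" for j
  define c where "c j = ess_norm t0 (\<lambda>t. a j t / A\<^sub>\<Omega> t)" for j
  have meas\<^sub>\<Omega>: "A\<^sub>\<Omega> \<in> borel_measurable (lebesgue_on {t0..})"
    unfolding A\<^sub>\<Omega>_def using \<Omega> by (intro borel_measurable_sum meas) auto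
  have a_le: "AE t in lebesgue_on {t0..}. \<bar>a j t\<bar> \<le> b j" if "j \<in> J" for j
    unfolding b_def using bdd[OF that] by (rule AE_abs_le_ess_norm)
  have A_le: "AE t in lebesgue_on {t0..}. \<bar>A t\<bar> \<le> ess_norm t0 A"
  proof (rule AE_abs_le_ess_norm, rule ess_bounded_fromI)
    show "A \<in> borel_measurable (lebesgue_on {t0..})"
      unfolding A_def by (intro borel_measurable_sum meas)
    have "AE t in lebesgue_on {t0..}. \<forall>j\<in>J. \<bar>a j t\<bar> \<le> b j"
      using a_le J by (intro eventually_ball_finite) auto
    then show "AE t in lebesgue_on {t0..}. \<bar>A t\<bar> \<le> (\<Sum>j\<in>J. b j)"
      unfolding A_def by eventually_elim (auto intro: order_trans[OF sum_abs] sum_mono)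
  qed
  have quot_le: "AE t in lebesgue_on {t0..}. \<bar>a j t / A\<^sub>\<Omega> t\<bar> \<le> c j" if j: "j \<in> J" for j
    unfolding c_def
  proof (rule AE_abs_le_ess_norm, rule ess_bounded_fromI)
    show "(\<lambda>t. a j t / A\<^sub>\<Omega> t) \<in> borel_measurable (lebesgue_on {t0..})"
      by (intro borel_measurable_divide meas[OF j] meas\<^sub>\<Omega>)
    show "AE t in lebesgue_on {t0..}. \<bar>a j t / A\<^sub>\<Omega> t\<bar> \<le> b j / \<alpha>"
      using a_le[OF j] \<alpha>_le
    proof eventually_elim
      case (elim t)
      then show ?case using \<open>\<alpha> > 0\<close> unfolding abs_divide by (intro frac_le) auto
    qed
  qed
  have "AE t in lebesgue_on {t0..}. (\<forall>j\<in>J. \<bar>a j t\<bar> \<le> b j \<and> \<bar>a j t / A\<^sub>\<Omega> t\<bar> \<le> c j \<and>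
      0 \<le> t - h j t \<and> t - h j t \<le> \<tau> j) \<and> \<bar>A t\<bar> \<le> ess_norm t0 A \<and> \<alpha> \<le> A\<^sub>\<Omega> t"
    by (intro eventually_conj eventually_ball_finite ballI J a_le quot_le h A_le \<alpha>_le)
  then obtain N where N: "negligible N" and coeff: "\<And>t. t \<in> {t0..} - N \<Longrightarrow>
      (\<forall>j\<in>J. \<bar>a j t\<bar> \<le> b j \<and> \<bar>a j t / A\<^sub>\<Omega> t\<bar> \<le> c j \<and>
      0 \<le> t - h j t \<and> t - h j t \<le> \<tau> j) \<and> \<bar>A t\<bar> \<le> ess_norm t0 A \<and> \<alpha> \<le> A\<^sub>\<Omega> t"
    by (rule AE_lebesgue_on_atLeast_negligible) blast
  \<comment> \<open>A half-line is not negligible, so some regular point exists; the inequalities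
    there force the norms to be nonnegative.\<close>
  have "\<not> {t0..} \<subseteq> N" using N not_negligible_atLeast negligible_subset by blast
  then obtain t1 where "t1 \<in> {t0..} - N" by blast
  from coeff[OF this] have nonneg: "ess_norm t0 A \<ge> 0" "\<And>j. j \<in> J \<Longrightarrow> b j \<ge> 0 \<and> c j \<ge> 0"
    using order_trans[OF abs_ge_zero] by blast+
  have "delay_coefficients J \<Omega> a h \<tau> b c \<alpha> (ess_norm t0 A) t0 N"
  proof
    fix t assume t: "t \<in> {t0..} - N"
    note * = coeff[OF t]
    show "\<alpha> \<le> (\<Sum>j\<in>\<Omega>. a j t)" "\<bar>\<Sum>j\<in>J. a j t\<bar> \<le> ess_norm t0 A"
      using * by (simp_all add: A_def A\<^sub>\<Omega>_def)
    fix j assume "j \<in> J"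
    with * have j: "\<bar>a j t\<bar> \<le> b j" "\<bar>a j t / A\<^sub>\<Omega> t\<bar> \<le> c j" "0 \<le> t - h j t" "t - h j t \<le> \<tau> j"
      and "\<alpha> \<le> A\<^sub>\<Omega> t" by blast+
    with \<open>\<alpha> > 0\<close> have "\<bar>a j t\<bar> / A\<^sub>\<Omega> t \<le> c j" "A\<^sub>\<Omega> t > 0" by simp_all
    then show "\<bar>a j t\<bar> \<le> c j * (\<Sum>i\<in>\<Omega>. a i t)"
      unfolding A\<^sub>\<Omega>_def by (simp add: pos_divide_le_eq)
    show "\<bar>a j t\<bar> \<le> b j" "h j t \<le> t \<and> t - h j t \<le> \<tau> j"
      using j by simp_all
  qed (use J \<Omega> nonneg \<tau> \<open>\<alpha> > 0\<close> N in blast)+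
  then show ?thesis unfolding b_def c_def by (rule that)
qed

theorem theorem4p1:
  fixes t0 \<alpha> :: real and n :: nat and a h :: "nat \<Rightarrow> real \<Rightarrow> real" and \<tau> :: "nat \<Rightarrow> real"
    and \<Omega> :: "nat set" and A A\<^sub>\<Omega> :: "real \<Rightarrow> real"
  assumes "n \<ge> 1"
    and "\<And>j. j \<in> {1..n} \<Longrightarrow> a j \<in> borel_measurable (lebesgue_on {t0..})"
    and "\<And>j. j \<in> {1..n} \<Longrightarrow> h j \<in> borel_measurable (lebesgue_on {t0..})"
    and "\<And>j. j \<in> {1..n} \<Longrightarrow> ess_bounded_from t0 (a j)"
    and "\<And>j. j \<in> {1..n} \<Longrightarrow> \<tau> j \<ge> 0"
    and "\<And>j. j \<in> {1..n} \<Longrightarrow> AE t in lebesgue_on {t0..}. 0 \<le> t - h j t \<and> t - h j t \<le> \<tau> j"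
    and "A = (\<lambda>t. \<Sum>j=1..n. a j t)"
    and "\<Omega> \<subseteq> {1..n}" and "\<Omega> \<noteq> {}"
    and "A\<^sub>\<Omega> = (\<lambda>t. \<Sum>j\<in>\<Omega>. a j t)"
    and "\<alpha> > 0" and "AE t in lebesgue_on {t0..}. A\<^sub>\<Omega> t \<ge> \<alpha>"
    and "((\<Sum>j=1..n. \<tau> j * ess_norm t0 (a j)) < 1 \<and>
          (\<Sum>j=1..n. ess_norm t0 (a j)) * (\<Sum>j\<in>\<Omega>. \<tau> j * ess_norm t0 (\<lambda>t. a j t / A\<^sub>\<Omega> t))
            + (\<Sum>j\<in>{1..n} - \<Omega>. ess_norm t0 (\<lambda>t. a j t / A\<^sub>\<Omega> t)) < 1)
       \<or> ((\<Sum>j=1..n. \<tau> j * ess_norm t0 (a j)) < 1 \<and>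
          ess_norm t0 A * (\<Sum>j\<in>\<Omega>. \<tau> j * ess_norm t0 (\<lambda>t. a j t / A\<^sub>\<Omega> t))
            < (1 - (\<Sum>j=1..n. \<tau> j * ess_norm t0 (a j)))
              * (1 - (\<Sum>j\<in>{1..n} - \<Omega>. ess_norm t0 (\<lambda>t. a j t / A\<^sub>\<Omega> t))))"
  shows "uniformly_exponentially_stable t0 n a h"
proof -
  define b where "b j = ess_norm t0 (a j)" for j
  define c where "c j = ess_norm t0 (\<lambda>t. a j t / A\<^sub>\<Omega> t)" for j
  obtain N where N: "delay_coefficients {1..n} \<Omega> a h \<tau> b c \<alpha> (ess_norm t0 A) t0 N"
    using delay_coefficients_ess_norm[of "{1..n}" \<Omega> a t0 \<tau> h \<alpha>] assms(2,4-6,8,11,12)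
    unfolding b_def c_def assms(7,10) by blast
  note stable = delay_coefficients.exponential_stability_if_estimate[OF N refl]
  have nonneg: "\<tau> j \<ge> 0 \<and> b j \<ge> 0 \<and> c j \<ge> 0" if "j \<in> {1..n}" for j
    using delay_coefficients.nonneg[OF N that] .
  define P where "P = (\<Sum>j\<in>\<Omega>. \<tau> j * c j)"
  define Q where "Q = (\<Sum>j\<in>{1..n} - \<Omega>. c j)"
  define K where "K = (\<Sum>j=1..n. \<tau> j * b j)"
  have P: "P \<ge> 0" and S: "(\<Sum>j=1..n. b j) \<ge> 0" and C: "(\<Sum>j\<in>\<Omega>. c j) \<ge> 0"
    unfolding P_def using nonneg assms(8) by (auto intro!: sum_nonneg mult_nonneg_nonneg)
  from assms(13) consider
      (crude) "(\<Sum>j=1..n. b j) * P + Q < 1"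
    | (refined) "K < 1" "ess_norm t0 A * P < (1 - K) * (1 - Q)"
    unfolding P_def Q_def K_def b_def c_def by blast
  then show ?thesis
  proof cases
    case crude
    show ?thesis
    proof (rule stable[OF crude])
      show "0 \<le> P + 1 / \<alpha>" "0 \<le> 1 + 2 * (\<Sum>j\<in>\<Omega>. c j)" using P C assms(11) by auto
    qed (unfold P_def Q_def, rule perturbed_solution.value_estimate_crude)
  next
    case refined
    \<comment> \<open>Condition (b) divided by the positive number \<open>1 - K\<close> says that
      the coefficient of \<open>m\<close> is below 1.\<close>
    have "ess_norm t0 A * (P / (1 - K)) + Q < 1"
    proof -
      have "ess_norm t0 A * (P / (1 - K)) < 1 - Q"
        using refined by (simp add: pos_divide_less_eq mult.commute)
      then show ?thesis by simp
    qed
    then show ?thesis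
    proof (rule stable)
      show "0 \<le> P / (1 - K) + 1 / \<alpha>"
        "0 \<le> 1 + 2 * (\<Sum>j\<in>\<Omega>. c j) + 2 * (P / (1 - K)) * (\<Sum>j=1..n. b j)"
        using P C S refined assms(11) by auto
    qed (unfold P_def Q_def K_def, rule perturbed_solution.value_estimate_refined, use refined in \<open>auto simp: K_def\<close>)
  qed
qed

end
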